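(* For every integer $i\ge 0$, let $s_i$ denote the first (smallest) term of the sequence $S_i$ defined in the context. Then for every $i\ge 0$, the base-3 representation of $s_i$ is the same string as the base-$\frac{3}{2}$ representation of $2i$. Equivalently, the Stanley cross-sequence $(s_0,s_1,s_2,\dots)$ written in base 3 coincides, term by term, with the sequence of even non-negative integers $0,2,4,\dots$ written in base $\frac{3}{2}$.
   Context: A sequence (or set) of integers is 3-free if it contains no three distinct terms $x<y<z$ with $y-x=z-y$. The greedy partition of the non-negative integers into 3-free sequences is defined as follows. $S_0$ is the lexicographically earliest 3-free sequence of non-negative integers: it is increasing, starts with $0$, and each next term is the smallest integer larger than the previous term that creates no 3-term arithmetic progression with earlier terms. For $n\ge1$, $S_n$ is the lexicographically earliest 3-free increasing sequence of non-negative integers that are not used in any $S_i$ with $i<n$: it starts with the smallest non-negative integer not in $\bigcup_{i<n}S_i$, and each next term is the smallest integer larger than the previous term, not in $\bigcup_{i<n}S_i$, that creates no 3-term arithmetic progression with earlier terms of $S_n$. (Each $S_n$ is infinite and exists for all $n$.) The sequence of first terms of $S_0,S_1,S_2,\dots$ is called the Stanley cross-sequence ($0,2,7,21,23,64,\dots$). Base-$\frac32$ representation: the representation of $0$ is the string $0$; for $N\ge1$ write $N=3q+r$ with $r\in\{0,1,2\}$; if $q=0$ the representation is the one-digit string $r$, otherwise it is the base-$\frac32$ representation of $2q$ followed by the digit $r$. (E.g. $3\mapsto 20$, $5\mapsto 22$, $6\mapsto 210$.) A string $a_n\cdots a_0$ with digits in $\{0,1,2\}$ then satisfies $N=\sum_k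 a_k(3/2)^k$. The base-3 representation is the usual ternary one (with $0\mapsto 0$). *)

theory Defs
  imports Main
begin

definition three_free :: "nat set \<Rightarrow> bool" where
  "three_free A \<longleftrightarrow> \<not> (\<exists>x\<in>A. \<exists>y\<in>A. \<exists>z\<in>A. x < y \<and> y < z \<and> y - x = z - y)"

(* The terms, in increasing order, of the greedy 3-free sequence of naturals avoiding U.
   LEAST is meaningful as long as an admissible next term exists; this holds for every U
   with infinite complement. *)
fun greedy_seq :: "nat set \<Rightarrow> nat \<Rightarrow> nat" where
  "greedy_seq U 0 = (LEAST x. x \<notin> U)"
| "greedy_seq U (Suc k) =
     (LEAST x. greedy_seq U k < x \<and> x \<notin> U \<and> three_free (insert x (greedy_seq U ` {..k})))"

fun stanley_seq :: "nat \<Rightarrow> nat \<Rightarrow> nat" where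
  "stanley_seq n = greedy_seq (\<Union>i\<in>{..<n}. range (stanley_seq i))"

declare stanley_seq.simps [simp del]

definition stanley_cross :: "nat \<Rightarrow> nat" where
  "stanley_cross n = stanley_seq n 0"

(* Digit strings are lists with the most significant digit first; 0 is represented by [0]. *)
fun base_three :: "nat \<Rightarrow> nat list" where
  "base_three N = (if N div 3 = 0 then [N mod 3] else base_three (N div 3) @ [N mod 3])"

declare base_three.simps [simp del]

function base_three_halves :: "nat \<Rightarrow> nat list" where
  "base_three_halves N =
     (if N div 3 = 0 then [N mod 3] else base_three_halves (2 * (N div 3)) @ [N mod 3])"
  by auto
termination
  by (relation "measure id") auto

declare base_three_halves.simps [simp del]

end

(* Write f n for the index of the sequence containing n.  The recursion
   f (3 n + k) = (3 f n + k) div 2 for k < 3 defines a colouring of the naturals, and the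
   theorem follows once this colouring is seen to be the greedy one.  Colour classes are
   3-free: a colour c allows only two last ternary digits, so the members of a progression of
   colour c have equal last digits, which can be stripped.  Conversely, for c < f n some
   progression x < y < n has x and y of colour c; this is proved digit by digit, where carries
   make it necessary to control three kinds of approximate progressions at the same time.
   Finally, the least number s i of colour i satisfies s i = 3 s q + r with 2 i = 3 q + r, which
   is the recursion for the digits of 2 i in base 3/2. *)

theory Submission
  imports Defs "HOL-Library.Infinite_Set"
begin

section \<open>The colouring\<close>

fun colour :: "nat \<Rightarrow> nat" where
  "colour n = (if n = 0 then 0 else (3 * colour (n div 3) + n mod 3) div 2)"

declare colour.simps [simp del]

lemma colour_0 [simp]: "colour 0 = 0"
  by (simp add: colour.simps)

lemma colour_digit:
  assumes "k < 3"
  shows "colour (3 * m + k) = (3 * colour m + k) div 2"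
  using assms by (cases "3 * m + k = 0") (auto simp: colour.simps[of "3 * m + k"])

text \<open>Over a parent of colour \<open>2 * i div 3\<close> this digit makes the number to be
  halved exactly \<open>2 * i\<close>; it is the least digit there that yields
  \<open>i\<close>.\<close>

lemma colour_least_digit: "colour (3 * m + 2 * i mod 3) = i" if "colour m = 2 * i div 3"
  using that by (simp add: colour_digit)

lemma ternary_cases:
  fixes n :: nat
  obtains m k where "n = 3 * m + k" "k < 3"
  by (metis mod_less_divisor mult_div_mod_eq zero_less_numeral)

text \<open>Halving loses one bit: \<open>3 * colour p + a\<close> is \<open>2 * c\<close> or
  \<open>2 * c + 1\<close>, and division by 3 recovers digit and parent colour from either.\<close>

lemma colour_parent:
  assumes "colour (3 * p + a) = c" "a < 3"
  shows "a = 2 * c mod 3 \<and> colour p = 2 * c div 3 \<or>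
    a = (2 * c + 1) mod 3 \<and> colour p = (2 * c + 1) div 3"
proof -
  have "2 * c = 3 * colour p + a \<or> 2 * c + 1 = 3 * colour p + a"
    using assms by (simp add: colour_digit) linarith
  then show ?thesis using assms(2) by auto
qed

lemma colour_no_progression:
  assumes "colour x = c" "colour y = c" "colour z = c" "x + z = 2 * y"
  shows "x = y"
  using assms
proof (induction y arbitrary: x z c rule: less_induct)
  case (less y)
  obtain x' a where x: "x = 3 * x' + a" "a < 3" by (rule ternary_cases)
  obtain y' b where y: "y = 3 * y' + b" "b < 3" by (rule ternary_cases)
  obtain z' e where z: "z = 3 * z' + e" "e < 3" by (rule ternary_cases)
  define u v where "u = 2 * c mod 3" and "v = (2 * c + 1) mod 3"
  have uv: "u = 0 \<and> v = 1 \<or> u = 1 \<and> v = 2 \<or> u = 2 \<and> v = 0"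
    unfolding u_def v_def by presburger
  have parents:
    "a = u \<and> colour x' = 2 * c div 3 \<or> a = v \<and> colour x' = (2 * c + 1) div 3"
    "b = u \<and> colour y' = 2 * c div 3 \<or> b = v \<and> colour y' = (2 * c + 1) div 3"
    "e = u \<and> colour z' = 2 * c div 3 \<or> e = v \<and> colour z' = (2 * c + 1) div 3"
    using less.prems x y z colour_parent unfolding u_def v_def by blast+
  \<comment> \<open>Modulo 3 the last digits sum to 0. Only \<open>u\<close> and its cyclic
    successor \<open>v\<close> are available, and a mixed triple sums to 1 or 2 modulo 3, so all
    three digits agree.\<close>
  have "a + b + e = 3 * (2 * y' + b - x' - z')"
    using less.prems(4) x y z by linarith
  then have "3 dvd a + b + e" by simp
  moreover have "a = u \<or> a = v" "b = u \<or> b = v" "e = u \<or> e = v"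
    using parents by blast+
  ultimately have eq: "a = b" "e = b"
    using uv by (auto simp: dvd_eq_mod_eq_0 mod_Suc)
  moreover have "colour x' = colour y'" "colour z' = colour y'"
    using parents uv eq by auto
  moreover have "x' + z' = 2 * y'"
    using less.prems(4) x y z calculation by simp
  ultimately show ?case
    using less.IH[of y' x' "colour y'" z'] x y by (cases "y' < y") auto
qed

section \<open>Progressions with a carry\<close>

text \<open>The parameter \<^term>\<open>s\<close> is the carry shifted by one, so that it ranges over 0, 1, 2 and
  \<^term>\<open>s = (1::nat)\<close> describes genuine progressions.\<close>

definition progression :: "nat \<Rightarrow> nat \<Rightarrow> nat \<Rightarrow> nat \<Rightarrow> bool" where
  "progression c d s n \<longleftrightarrow>
     (\<exists>x y. x \<le> n \<and> x + n + s = 2 * y + 1 \<and> colour x = c \<and> colour y = d)"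

lemma progression_refl: "progression (colour n) (colour n) 1 n"
  unfolding progression_def by (intro exI[of _ n]) simp

text \<open>Appends the digits \<open>a\<close>, \<open>b\<close>, \<open>k\<close> to
  \<open>x\<close>, \<open>y\<close>, \<open>m\<close>. The digit equation is one column of the
  addition, relating the carry \<open>s\<close> of the prefixes to the carry \<open>t\<close> of the
  extended numbers. The last hypothesis keeps the order of the outer terms in the case
  \<open>x = m\<close>.\<close>

lemma lift_progression:
  assumes "progression c d s m"
    and "a < 3" "b < 3" "k < 3" "a + k + t + 2 = 2 * b + 3 * s"
    and "3 * c + a \<in> {2 * c', 2 * c' + 1}" "3 * d + b \<in> {2 * d', 2 * d' + 1}"
    and "c \<noteq> colour m \<or> a \<le> k"
  shows "progression c' d' t (3 * m + k)"
proof -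
  obtain x y where xy: "x \<le> m" "x + m + s = 2 * y + 1" "colour x = c" "colour y = d"
    using assms(1) unfolding progression_def by blast
  have "3 * x + a \<le> 3 * m + k"
    using xy assms(2,8) by (cases "x = m") auto
  moreover have "(3 * x + a) + (3 * m + k) + t = 2 * (3 * y + b) + 1"
    using xy(2) assms(5) by presburger
  moreover have "colour (3 * x + a) = c'" "colour (3 * y + b) = d'"
    using xy assms(2,3,6,7) by (auto simp: colour_digit)
  ultimately show ?thesis
    unfolding progression_def by blast
qed

text \<open>\<open>Z\<close>, \<open>M\<close>, \<open>P\<close> stand for carry zero, minus one,
  plus one. \<open>P\<close> pairs neighbouring colours because for \<open>r = 2\<close> the two
  digits yielding \<open>q\<close> are 2 and 0, under parents of colours \<open>Q\<close> and
  \<open>Suc Q\<close>; cases \<open>h\<close> and \<open>i\<close> rely on this. \<open>Z\<close>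
  includes \<open>colour m\<close> itself, which cases \<open>c\<close> and \<open>h\<close> may
  reach.\<close>

lemma progressions_step:
  assumes Z: "\<And>c. c \<le> colour m \<Longrightarrow> progression c c 1 m"
    and M: "\<And>c. c < colour m \<Longrightarrow> progression c c 0 m"
    and P: "\<And>c. c < colour m \<Longrightarrow> progression c (Suc c) 2 m"
    and "k < 3" and "q < colour (3 * m + k)"
  shows "progression q q 1 (3 * m + k) \<and> progression q q 0 (3 * m + k) \<and>
    progression q (Suc q) 2 (3 * m + k)"
proof -
  obtain Q r where decomp: "2 * q = 3 * Q + r" and "r < 3" by (rule ternary_cases)
  have lt: "3 * Q + r + 2 \<le> 3 * colour m + k"
    using assms(4,5) decomp by (simp add: colour_digit)
  have "r = 0 \<or> r = 1 \<or> r = 2" "k = 0 \<or> k = 1 \<or> k = 2"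
    using \<open>r < 3\<close> \<open>k < 3\<close> by linarith+
  \<comment> \<open>In each case the two numbers after \<open>of\<close> are the digits
    \<open>a\<close> and \<open>b\<close>; \<open>lt\<close> puts the parent colour in the range of
    the hypothesis used.\<close>
  then consider (a) "r = 0" "k = 0"
    | (b) "r = 0" "k = 1"
    | (c) "r = 0" "k = 2"
    | (d) "r = 1" "k = 0"
    | (e) "r = 1" "k = 1"
    | (f) "r = 1" "k = 2"
    | (g) "r = 2" "k = 0"
    | (h) "r = 2" "k = 1"
    | (i) "r = 2" "k = 2"
    by blast
  then show ?thesis
  proof cases
    case a
    have "progression q q 1 (3 * m + k)"
      by (rule lift_progression[OF Z[of "Q"], of 0 0]) (use a decomp lt in auto)
    moreover have "progression q q 0 (3 * m + k)"
      by (rule lift_progression[OF M[of "Q"], of 0 1]) (use a decomp lt in auto)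
    moreover have "progression q (Suc q) 2 (3 * m + k)"
      by (rule lift_progression[OF M[of "Q"], of 0 2]) (use a decomp lt in auto)
    ultimately show ?thesis by blast
  next
    case b
    have "progression q q 1 (3 * m + k)"
      by (rule lift_progression[OF Z[of "Q"], of 1 1]) (use b decomp lt in auto)
    moreover have "progression q q 0 (3 * m + k)"
      by (rule lift_progression[OF Z[of "Q"], of 0 0]) (use b decomp lt in auto)
    moreover have "progression q (Suc q) 2 (3 * m + k)"
      by (rule lift_progression[OF P[of "Q"], of 1 0]) (use b decomp lt in auto)
    ultimately show ?thesis by blast
  next
    case c
    have "progression q q 1 (3 * m + k)"
      by (rule lift_progression[OF Z[of "Q"], of 0 1]) (use c decomp lt in auto)
    moreover have "progression q q 0 (3 * m + k)"
      by (rule lift_progression[OF Z[of "Q"], of 1 1]) (use c decomp lt in auto)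
    moreover have "progression q (Suc q) 2 (3 * m + k)"
      by (rule lift_progression[OF Z[of "Q"], of 1 2]) (use c decomp lt in auto)
    ultimately show ?thesis by blast
  next
    case d
    have "progression q q 1 (3 * m + k)"
      by (rule lift_progression[OF Z[of "Q"], of 2 1]) (use d decomp lt in auto)
    moreover have "progression q q 0 (3 * m + k)"
      by (rule lift_progression[OF M[of "Q"], of 2 2]) (use d decomp lt in auto)
    moreover have "progression q (Suc q) 2 (3 * m + k)"
      by (rule lift_progression[OF P[of "Q"], of 2 0]) (use d decomp lt in auto)
    ultimately show ?thesis by blast
  next
    case e
    have "progression q q 1 (3 * m + k)"
      by (rule lift_progression[OF Z[of "Q"], of 1 1]) (use e decomp lt in auto)
    moreover have "progression q q 0 (3 * m + k)"
      by (rule lift_progression[OF M[of "Q"], of 1 2]) (use e decomp lt in auto)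
    moreover have "progression q (Suc q) 2 (3 * m + k)"
      by (rule lift_progression[OF P[of "Q"], of 1 0]) (use e decomp lt in auto)
    ultimately show ?thesis by blast
  next
    case f
    have "progression q q 1 (3 * m + k)"
      by (rule lift_progression[OF Z[of "Q"], of 2 2]) (use f decomp lt in auto)
    moreover have "progression q q 0 (3 * m + k)"
      by (rule lift_progression[OF Z[of "Q"], of 1 1]) (use f decomp lt in auto)
    moreover have "progression q (Suc q) 2 (3 * m + k)"
      by (rule lift_progression[OF P[of "Q"], of 2 1]) (use f decomp lt in auto)
    ultimately show ?thesis by blast
  next
    case g
    have "progression q q 1 (3 * m + k)"
      by (rule lift_progression[OF Z[of "Suc Q"], of 0 0]) (use g decomp lt in auto)
    moreover have "progression q q 0 (3 * m + k)"
      by (rule lift_progression[OF M[of "Q"], of 2 2]) (use g decomp lt in auto)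
    moreover have "progression q (Suc q) 2 (3 * m + k)"
      by (rule lift_progression[OF M[of "Suc Q"], of 0 2]) (use g decomp lt in auto)
    ultimately show ?thesis by blast
  next
    case h
    have "progression q q 1 (3 * m + k)"
      by (rule lift_progression[OF P[of "Q"], of 2 0]) (use h decomp lt in auto)
    moreover have "progression q q 0 (3 * m + k)"
      by (rule lift_progression[OF Z[of "Suc Q"], of 0 0]) (use h decomp lt in auto)
    moreover have "progression q (Suc q) 2 (3 * m + k)"
      by (rule lift_progression[OF Z[of "Suc Q"], of 0 1]) (use h decomp lt in auto)
    ultimately show ?thesis by blast
  next
    case i
    have "progression q q 1 (3 * m + k)"
      by (rule lift_progression[OF Z[of "Q"], of 2 2]) (use i decomp lt in auto)
    moreover have "progression q q 0 (3 * m + k)"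
      by (rule lift_progression[OF P[of "Q"], of 2 0]) (use i decomp lt in auto)
    moreover have "progression q (Suc q) 2 (3 * m + k)"
      by (rule lift_progression[OF P[of "Q"], of 2 1]) (use i decomp lt in auto)
    ultimately show ?thesis by blast
  qed
qed

lemma progressions_below:
  assumes "q < colour n"
  shows "progression q q 1 n \<and> progression q q 0 n \<and> progression q (Suc q) 2 n"
  using assms
proof (induction n arbitrary: q rule: less_induct)
  case (less n)
  obtain m k where n: "n = 3 * m + k" "k < 3" by (rule ternary_cases)
  have "n \<noteq> 0" using less.prems by (metis colour_0 not_less0)
  then have "m < n" using n by linarith
  then show ?case
    \<comment> \<open>The trivial progression at \<open>m\<close> supplies \<open>Z\<close> for the
      colour of \<open>m\<close> itself.\<close>
    using less progression_refl[of m] n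
    by (metis le_neq_implies_less progressions_step)
qed

lemma colour_progression:
  assumes "c < colour n"
  obtains x y where "x < y" "y < n" "x + n = 2 * y" "colour x = c" "colour y = c"
proof -
  obtain x y where "x \<le> n" "x + n = 2 * y" "colour x = c" "colour y = c"
    using progressions_below[OF assms] unfolding progression_def by auto
  moreover from this have "x \<noteq> n" using assms by auto
  moreover from calculation have "x < y" "y < n" by linarith+
  ultimately show ?thesis using that by blast
qed

section \<open>Colour classes are the greedy sequences\<close>

lemma infinite_colour_class: "infinite {x. colour x = c}"
proof (induction c rule: less_induct)
  case (less c)
  show ?case
  proof (cases "c = 0")
    case True
    \<comment> \<open>Colour 0 is its own parent colour, so the induction hypothesis gives nothing
      and explicit members are needed.\<close>
    have "colour (3 ^ j) = 0" for j :: nat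
    proof (induction j)
      case 0
      then show ?case by (simp add: colour.simps)
    next
      case (Suc j)
      then show ?case using colour_digit[of 0 "3 ^ j"] by simp
    qed
    then have "range (\<lambda>j. 3 ^ j) \<subseteq> {x. colour x = c}" using True by auto
    moreover have "inj (\<lambda>j. 3 ^ j :: nat)" by (simp add: inj_def)
    ultimately show ?thesis by (metis finite_imageD finite_subset infinite_UNIV_nat)
  next
    case False
    let ?h = "\<lambda>m. 3 * m + 2 * c mod 3"
    have "?h ` {x. colour x = 2 * c div 3} \<subseteq> {x. colour x = c}"
      using colour_least_digit by auto
    moreover have "inj_on ?h {x. colour x = 2 * c div 3}" by (simp add: inj_on_def)
    moreover have "infinite {x. colour x = 2 * c div 3}" using less False by simp
    ultimately show ?thesis by (metis finite_imageD finite_subset)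
  qed
qed

lemma three_free_colour_class: "three_free {x. colour x = c}"
  unfolding three_free_def
proof
  assume "\<exists>x\<in>{x. colour x = c}. \<exists>y\<in>{x. colour x = c}. \<exists>z\<in>{x. colour x = c}.
    x < y \<and> y < z \<and> y - x = z - y"
  then obtain x y z where "x < y" "y < z" "y - x = z - y" "colour x = c" "colour y = c" "colour z = c"
    by blast
  moreover from this have "x + z = 2 * y" by linarith
  ultimately show False using colour_no_progression[of x c y z] by simp
qed

lemma three_free_subset: "three_free A \<Longrightarrow> B \<subseteq> A \<Longrightarrow> three_free B"
  unfolding three_free_def by blast

lemma enumerate_image_atMost:
  fixes A :: "nat set"
  assumes "infinite A"
  shows "enumerate A ` {..k} = {x \<in> A. x \<le> enumerate A k}"
proof safe
  fix x assume "x \<in> A" "x \<le> enumerate A k"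
  moreover from this obtain j where "x = enumerate A j"
    using assms by (metis enumerate_Ex)
  ultimately show "x \<in> enumerate A ` {..k}"
    using assms by simp
qed (use assms in \<open>auto simp: enumerate_in_set\<close>)

text \<open>Class members are never blocked, since the class is 3-free. A candidate of larger colour
  is blocked, since it ends a progression of colour \<open>c\<close>.\<close>

lemma greedy_seq_colour:
  "greedy_seq {x. colour x < c} k = enumerate {x. colour x = c} k"
proof (induction k rule: less_induct)
  case (less k)
  let ?A = "{x. colour x = c}"
  have inf: "infinite ?A" by (rule infinite_colour_class)
  show ?case
  proof (cases k)
    case 0
    have "(LEAST x. \<not> colour x < c) = (LEAST x. colour x = c)"
    proof (rule Least_equality)
      have "\<exists>x. colour x = c"
        using infinite_imp_nonempty[OF inf] by blast
      then have "colour (LEAST x. colour x = c) = c" by (rule LeastI_ex)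
      then show "\<not> colour (LEAST x. colour x = c) < c" by simp
    next
      fix x assume "\<not> colour x < c"
      then consider "colour x = c" | "c < colour x" by linarith
      then obtain y where "colour y = c" "y \<le> x"
      proof cases
        case 2
        obtain y where "y < x" "colour y = c" by (rule colour_progression[OF 2])
        then show ?thesis using that[of y] by simp
      qed (use that in blast)
      then show "(LEAST x. colour x = c) \<le> x"
        using Least_le[of "\<lambda>x. colour x = c" y] by simp
    qed
    then show ?thesis using 0 by (simp add: enumerate_0)
  next
    case (Suc j)
    have img: "greedy_seq {x. colour x < c} ` {..j} = {x \<in> ?A. x \<le> enumerate ?A j}"
      using less Suc enumerate_image_atMost[OF inf, of j] by (simp add: image_def)
    have step: "enumerate ?A (Suc j) = (LEAST x. x \<in> ?A \<and> enumerate ?A j < x)"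
      by (rule enumerate_Suc''[OF inf])
    have "(LEAST x. enumerate ?A j < x \<and> x \<notin> {x. colour x < c} \<and>
        three_free (insert x {x \<in> ?A. x \<le> enumerate ?A j})) = enumerate ?A (Suc j)"
    proof (rule Least_equality)
      have "enumerate ?A (Suc j) \<in> ?A" by (rule enumerate_in_set[OF inf])
      moreover from this
      have "three_free (insert (enumerate ?A (Suc j)) {x \<in> ?A. x \<le> enumerate ?A j})"
        by (intro three_free_subset[OF three_free_colour_class[of c]]) auto
      moreover have "enumerate ?A j < enumerate ?A (Suc j)" by (rule enumerate_step[OF inf])
      ultimately show "enumerate ?A j < enumerate ?A (Suc j) \<and>
          enumerate ?A (Suc j) \<notin> {x. colour x < c} \<and>
          three_free (insert (enumerate ?A (Suc j)) {x \<in> ?A. x \<le> enumerate ?A j})"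
        by simp
    next
      fix w
      assume w: "enumerate ?A j < w \<and> w \<notin> {x. colour x < c} \<and>
        three_free (insert w {x \<in> ?A. x \<le> enumerate ?A j})"
      show "enumerate ?A (Suc j) \<le> w"
      proof (rule ccontr)
        assume "\<not> enumerate ?A (Suc j) \<le> w"
        \<comment> \<open>No class member lies strictly between consecutive terms, so the
          progression found below \<open>w\<close> consists of terms already chosen.\<close>
        then have least: "v \<le> enumerate ?A j" if "colour v = c" "v \<le> w" for v
          using that not_less_Least[of v "\<lambda>x. x \<in> ?A \<and> enumerate ?A j < x"] step by fastforce
        then have "colour w \<noteq> c" using w leD by blast
        then have "c < colour w" using w by simp
        then obtain x y where xy: "x < y" "y < w" "x + w = 2 * y" "colour x = c" "colour y = c"
          by (rule colour_progression)
        then have "x \<le> enumerate ?A j" "y \<le> enumerate ?A j" "y - x = w - y"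
          using least by auto
        then show False
          using w xy unfolding three_free_def by blast
      qed
    qed
    then show ?thesis using Suc less img by simp
  qed
qed

lemma stanley_seq_colour: "stanley_seq c = enumerate {x. colour x = c}"
proof (induction c rule: less_induct)
  case (less c)
  have "(\<Union>i\<in>{..<c}. range (stanley_seq i)) = {x. colour x < c}"
    using less by (auto simp: range_enumerate[OF infinite_colour_class])
  then show ?case by (simp add: stanley_seq.simps[of c] greedy_seq_colour fun_eq_iff)
qed

section \<open>The cross-sequence\<close>

lemma colour_stanley_cross: "colour (stanley_cross c) = c"
  using enumerate_in_set[OF infinite_colour_class[of c], of 0]
  by (simp add: stanley_cross_def stanley_seq_colour)

lemma stanley_cross_le: "stanley_cross (colour n) \<le> n"
  by (simp add: stanley_cross_def stanley_seq_colour enumerate_0 Least_le)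

text \<open>A number of colour \<open>Suc c\<close> ends a progression of colour \<open>c\<close>,
  so a smaller number of colour \<open>c\<close> exists.\<close>

lemma stanley_cross_less_Suc: "stanley_cross c < stanley_cross (Suc c)"
proof -
  obtain y where "y < stanley_cross (Suc c)" "colour y = c"
    by (rule colour_progression[of c "stanley_cross (Suc c)"]) (auto simp: colour_stanley_cross)
  then show ?thesis using stanley_cross_le[of y] by simp
qed

lemma stanley_cross_rec: "stanley_cross i = 3 * stanley_cross (2 * i div 3) + 2 * i mod 3"
proof (rule antisym)
  show "stanley_cross i \<le> 3 * stanley_cross (2 * i div 3) + 2 * i mod 3"
    by (metis colour_least_digit colour_stanley_cross stanley_cross_le)
next
  let ?q = "2 * i div 3"
  obtain m k where mk: "stanley_cross i = 3 * m + k" "k < 3" by (rule ternary_cases)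
  then have "(3 * colour m + k) div 2 = i"
    using colour_stanley_cross[of i] by (simp add: colour_digit)
  \<comment> \<open>Stripping the last digit of the least element may leave parent colour
    \<open>Suc ?q\<close>. Monotonicity then makes \<open>m\<close> larger by at least one, worth 3,
    which outweighs any last digit.\<close>
  then have "colour m = ?q \<and> 2 * i mod 3 \<le> k \<or> colour m = Suc ?q"
    using mk(2) by presburger
  then show "3 * stanley_cross ?q + 2 * i mod 3 \<le> stanley_cross i"
  proof
    assume "colour m = Suc ?q"
    then have "stanley_cross ?q < m"
      using stanley_cross_less_Suc[of ?q] stanley_cross_le[of m] by simp
    then show ?thesis using mk by (simp add: less_eq_Suc_le)
  next
    assume "colour m = ?q \<and> 2 * i mod 3 \<le> k"
    then show ?thesis using mk stanley_cross_le[of m] by simp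
  qed
qed

theorem theorem1:
  fixes i :: nat
  shows "base_three (stanley_cross i) = base_three_halves (2 * i)"
proof (induction i rule: less_induct)
  case (less i)
  let ?q = "2 * i div 3"
  have s: "stanley_cross i div 3 = stanley_cross ?q" "stanley_cross i mod 3 = 2 * i mod 3"
    by (subst stanley_cross_rec[of i], simp)+
  \<comment> \<open>Both digit recursions therefore stop at the same step.\<close>
  have zero: "stanley_cross ?q = 0 \<longleftrightarrow> ?q = 0"
    using colour_stanley_cross[of ?q] stanley_cross_le[of 0] by (metis colour_0 le_0_eq)
  show ?case
  proof (cases "?q = 0")
    case True
    then show ?thesis
      using s zero by (subst base_three.simps, subst base_three_halves.simps) simp
  next
    case False
    then have "?q < i" by linarith
    then show ?thesis
      using s zero False less by (subst base_three.simps, subst base_three_halves.simps) simp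
  qed
qed

end
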